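(* For every integer $n\ge 1$, $$(-1)^{n+1}(2n+1)!\left(1-2^{-2n-1}\right)\zeta(2n+1)+\left(n+\tfrac12\right)I_{2n}=\sum_{m=0}^{n-1}\binom{2n+1}{2m+1}B_{2(n-m)}\,\pi^{2(n-m)-1}\left(2^{2(n-m)}-1\right)I_{2m+1},$$ where $\zeta$ is the Riemann zeta function.
   Context: For integers $m\ge 1$, $I_m=\int_0^{\pi/2}\frac{t^m}{\sin t}\,dt$. The Bernoulli numbers $B_m$ are defined by $\frac{x}{e^x-1}=\sum_{m=0}^\infty B_m\frac{x^m}{m!}$ for $|x|<2\pi$. *)

theory Defs
  imports "HOL-Complex_Analysis.Complex_Analysis"
begin

text \<open>
  For \<open>m = 1\<close> the integrand has a removable singularity at \<open>0\<close>, where HOL assigns it the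
  value \<open>0 / 0 = 0\<close>; this does not affect the integral. The intended range is \<open>m \<ge> 1\<close>.
\<close>

definition I_integral :: "nat \<Rightarrow> real" where
  "I_integral m = integral {0..pi/2} (\<lambda>t. t ^ m / sin t)"

text \<open>
  The Riemann zeta function on the half-line \<open>s > 1\<close>, where it is given by its Dirichlet
  series. The value at \<open>s \<le> 1\<close> is not meaningful.
\<close>

definition riemann_zeta :: "real \<Rightarrow> real" where
  "riemann_zeta s = (\<Sum>k. 1 / real (Suc k) powr s)"

text \<open>
  The point \<open>x = 0\<close> is left out because HOL's \<open>0 / 0 = 0\<close> is not the value \<open>1\<close> of the continuous
  extension of \<open>x / (exp x - 1)\<close>. Existence and uniqueness are proved in \<open>ex1_bernoulli\<close>.
\<close>

definition bernoulli :: "nat \<Rightarrow> real" where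
  "bernoulli = (THE B. \<forall>x::real. x \<noteq> 0 \<and> \<bar>x\<bar> < 2 * pi \<longrightarrow>
     (\<lambda>m. B m * x ^ m / fact m) sums (x / (exp x - 1)))"

lemma powser_zero_coeffs:
  fixes a :: "nat \<Rightarrow> real"
  assumes "r > 0" and sums: "\<And>x. x \<noteq> 0 \<Longrightarrow> \<bar>x\<bar> < r \<Longrightarrow> (\<lambda>n. a n * x ^ n) sums 0"
  shows "a m = 0"
proof -
  define f where "f x = (if x = 0 then a 0 else 0)" for x :: real
  have f: "(\<lambda>n. a n * x ^ n) sums f x" if "norm x < r" for x
    using sums[of x] that powser_sums_zero[of a] by (auto simp: f_def)
  have "(f \<longlongrightarrow> a 0) (at 0)"
    using powser_limit_0_strong[of r a f] f \<open>r > 0\<close> by auto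
  moreover have "(f \<longlongrightarrow> 0) (at 0)"
    by (rule tendsto_eventually) (auto simp: f_def eventually_at_filter)
  ultimately have a0: "a 0 = 0"
    using tendsto_unique[of "at (0::real)"] by auto
  show ?thesis
  proof (rule ccontr)
    assume am: "a m \<noteq> 0"
    with a0 have "m > 0" by (cases m) auto
    obtain s where s: "s > 0" "\<And>z. z \<in> cball 0 s - {0} \<Longrightarrow> f z \<noteq> 0"
      using powser_0_nonzero[of r 0 a f m] \<open>r > 0\<close> f a0 am \<open>m > 0\<close>
      by (auto simp: f_def)
    have "f s \<noteq> 0" using s by auto
    with s(1) show False by (simp add: f_def)
  qed
qed

lemma exp_eq_1_small:
  fixes z :: complex
  assumes "exp z = 1" "norm z < 2 * pi"
  shows "z = 0"
proof -
  obtain n :: int where n: "Re z = 0" "Im z = of_int (2 * n) * pi"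
    using assms(1) by (auto simp: exp_eq_1)
  have "\<bar>Im z\<bar> < 2 * pi"
    using abs_Im_le_cmod[of z] assms(2) by linarith
  hence "\<bar>of_int n\<bar> * (2 * pi) < 1 * (2 * pi)"
    using n by (simp add: abs_mult)
  hence "\<bar>real_of_int n\<bar> < 1"
    by (simp only: mult_less_cancel_right) auto
  hence "n = 0" by linarith
  with n show ?thesis by (simp add: complex_eq_iff)
qed

lemma ex1_bernoulli:
  "\<exists>!B :: nat \<Rightarrow> real. \<forall>x::real. x \<noteq> 0 \<and> \<bar>x\<bar> < 2 * pi \<longrightarrow>
     (\<lambda>m. B m * x ^ m / fact m) sums (x / (exp x - 1))" (is "\<exists>!B. ?P B")
proof (rule ex_ex1I)
  define G :: "complex fps" where "G = fps_exp 1 - 1"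
  define F :: "complex fps" where "F = fps_X / G"
  have rad_G: "fps_conv_radius G = \<infinity>"
    using fps_conv_radius_diff[of "fps_exp (1::complex)" 1] by (simp add: G_def)
  have eval_G: "eval_fps G z = exp z - 1" for z
    by (simp add: G_def eval_fps_diff)
  have G1: "subdegree G = 1"
    by (rule subdegreeI) (auto simp: G_def)
  have G_nz: "eval_fps G z \<noteq> 0" if "z \<in> eball 0 (ereal (2 * pi))" "z \<noteq> 0" for z
    using exp_eq_1_small[of z] that by (auto simp: eval_G)
  have Min: "Min {ereal (2 * pi), fps_conv_radius (fps_X :: complex fps), fps_conv_radius G}
      = ereal (2 * pi)"
    by (simp add: rad_G)
  have rad_F: "ereal (2 * pi) \<le> fps_conv_radius F"
    using fps_conv_radius_divide[of G fps_X "ereal (2 * pi)"] G1 G_nz Min rad_G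
    by (simp add: F_def)
  have eval_F: "eval_fps F z = z / (exp z - 1)" if "norm z < 2 * pi" "z \<noteq> 0" for z
    using eval_fps_divide[of G fps_X "ereal (2 * pi)" z] G1 G_nz Min rad_G that
    by (simp add: F_def eval_G)
  have "?P (\<lambda>m. fact m * Re (fps_nth F m))"
  proof (intro allI impI, elim conjE)
    fix x :: real assume x: "x \<noteq> 0" "\<bar>x\<bar> < 2 * pi"
    have "ereal (norm (complex_of_real x)) < fps_conv_radius F"
      by (rule less_le_trans[OF _ rad_F]) (use x(2) in simp)
    hence "(\<lambda>m. fps_nth F m * of_real x ^ m) sums eval_fps F (of_real x)"
      by (rule sums_eval_fps)
    also have "eval_fps F (of_real x) = of_real (x / (exp x - 1))"
      using eval_F[of "of_real x"] x by (simp add: exp_of_real)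
    finally have "(\<lambda>m. Re (fps_nth F m * of_real x ^ m)) sums (x / (exp x - 1))"
      by (auto dest: sums_Re simp del: of_real_divide)
    moreover have "Re (fps_nth F m * of_real x ^ m) = fact m * Re (fps_nth F m) * x ^ m / fact m" for m
      by (simp flip: of_real_power)
    ultimately show "(\<lambda>m. fact m * Re (fps_nth F m) * x ^ m / fact m) sums (x / (exp x - 1))"
      by simp
  qed
  thus "\<exists>B. ?P B" by (rule exI[where x = "\<lambda>m. fact m * Re (fps_nth F m)"])
next
  fix B B' :: "nat \<Rightarrow> real"
  assume B: "?P B" and B': "?P B'"
  have "(B m - B' m) / fact m = 0" for m
  proof (rule powser_zero_coeffs[of "2 * pi"])
    fix x :: real assume x: "x \<noteq> 0" "\<bar>x\<bar> < 2 * pi"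
    have "(\<lambda>m. B m * x ^ m / fact m - B' m * x ^ m / fact m) sums
            (x / (exp x - 1) - x / (exp x - 1))"
      using B B' x by (intro sums_diff) auto
    thus "(\<lambda>m. (B m - B' m) / fact m * x ^ m) sums 0"
      by (simp add: diff_divide_distrib ring_distribs)
  qed simp
  thus "B = B'" by (intro ext) simp
qed

lemma bernoulli_sums:
  assumes "x \<noteq> 0" "\<bar>x\<bar> < 2 * pi"
  shows "(\<lambda>m. bernoulli m * x ^ m / fact m) sums (x / (exp x - 1))"
  using theI'[OF ex1_bernoulli, folded bernoulli_def] assms by simp

end

theory Submission
  imports Defs
begin

text \<open>
  Let \<open>P t = pi ^ (2 * n) * E (t / pi)\<close>, where \<open>E\<close> is the Euler polynomial of degree \<open>2 * n\<close>. Its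
  coefficients are such that \<open>(n + 1 / 2)\<close> times the integral of \<open>P t / sin t\<close> over \<open>{0..pi/2}\<close>
  is the \<open>I_integral (2 * n)\<close> term of the theorem minus its right-hand side. It remains to show that
  the integral of \<open>P t / sin t\<close> equals \<open>2 * (-1) ^ n * (2 * n)!\<close> times the sum of
  \<open>1 / (2 * k + 1) ^ (2 * n + 1)\<close> over all \<open>k\<close>, a sum that is
  \<open>(1 - 1 / 2 ^ (2 * n + 1)) * zeta (2 * n + 1)\<close> by \<open>odd_reciprocal_sums\<close>.

  The identity \<open>2 * sin t * (\<Sum>k<N. sin ((2 * k + 1) * t)) = 1 - cos (2 * N * t)\<close> and the
  Riemann-Lebesgue lemma show that the integral of \<open>P t / sin t\<close> is twice the sum over \<open>k\<close> of the
  integrals of \<open>P t * sin ((2 * k + 1) * t)\<close> (\<open>integral_div_sin_eq_sine_series\<close>).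

  These sine coefficients are computed in \<open>scaled_euler_sine_coefficient\<close> by repeated integration
  by parts. For that, \<open>P\<close> has to vanish at \<open>0\<close>, its derivative has to vanish at \<open>pi / 2\<close>,
  and its second derivative has to be \<open>2 * n * (2 * n - 1)\<close> times the polynomial for \<open>n - 1\<close>.
  The condition at \<open>pi / 2\<close> is the arithmetic heart of the matter: it is an identity between
  Bernoulli numbers that expresses \<open>cosh x * (x * tanh x) = x * sinh x\<close>
  (\<open>bernoulli_tanh_identity\<close>).
\<close>

section \<open>An identity for Bernoulli numbers of even index\<close>

definition bernoulli_fps :: "real fps" where
  "bernoulli_fps = Abs_fps (\<lambda>m. bernoulli m / fact m)"

text \<open>
  Turning the defining expansion into an identity of formal power series makes coefficient
  comparison available without further convergence arguments. The radius \<open>pi\<close> is a convenient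
  choice strictly inside the disc of convergence.
\<close>

lemma bernoulli_fps_mult_exp: "bernoulli_fps * (fps_exp 1 - 1) = fps_X"
proof -
  define G :: "real fps" where "G = fps_exp 1 - 1"
  have sums: "(\<lambda>m. fps_nth bernoulli_fps m * x ^ m) sums (x / (exp x - 1))"
    if "x \<noteq> 0" "\<bar>x\<bar> < 2 * pi" for x
    using bernoulli_sums[OF that] by (simp add: bernoulli_fps_def)
  have rad_F: "fps_conv_radius bernoulli_fps \<ge> pi"
    using conv_radius_geI[of "fps_nth bernoulli_fps" pi] sums[of pi]
    by (auto simp: fps_conv_radius_def sums_iff)
  have rad_G: "fps_conv_radius G = \<infinity>"
    using fps_conv_radius_diff[of "fps_exp (1::real)" 1] by (simp add: G_def)
  have rad: "pi \<le> fps_conv_radius (bernoulli_fps * G - fps_X)"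
    using fps_conv_radius_diff[of "bernoulli_fps * G" fps_X]
      fps_conv_radius_mult[of bernoulli_fps G] rad_F rad_G
    by (auto simp: min_def split: if_splits)
  have "fps_nth (bernoulli_fps * G - fps_X) m = 0" for m
  proof (rule powser_zero_coeffs[of pi])
    fix x :: real assume x: "x \<noteq> 0" "\<bar>x\<bar> < pi"
    have x': "ereal (norm x) < ereal pi" using x by simp
    have nF: "ereal (norm x) < fps_conv_radius bernoulli_fps"
      using x' rad_F by (rule less_le_trans)
    have nD: "ereal (norm x) < fps_conv_radius (bernoulli_fps * G - fps_X)"
      using x' rad by (rule less_le_trans)
    have nM: "ereal (norm x) < fps_conv_radius (bernoulli_fps * G)"
      using nF rad_G fps_conv_radius_mult[of bernoulli_fps G] by (auto intro: less_le_trans)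
    have "eval_fps bernoulli_fps x = x / (exp x - 1)"
      using sums[of x] x pi_gt_zero by (auto simp: eval_fps_def sums_iff)
    moreover have "eval_fps G x = exp x - 1"
      by (simp add: G_def eval_fps_diff)
    ultimately have "eval_fps (bernoulli_fps * G - fps_X) x = 0"
      using x nF nM rad_G by (simp add: eval_fps_diff eval_fps_mult)
    thus "(\<lambda>m. fps_nth (bernoulli_fps * G - fps_X) m * x ^ m) sums 0"
      using sums_eval_fps[OF nD] by simp
  qed simp
  thus ?thesis by (simp add: fps_eq_iff G_def)
qed

text \<open>
  This is the coefficient form of \<open>cosh x * (x * tanh x) = x * sinh x\<close>. With
  \<open>F x = x / (exp x - 1)\<close> the series \<open>D x = F (4 * x) - F (2 * x)\<close> equals \<open>x * tanh x - x\<close>, and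
  multiplying by \<open>2 * cosh x\<close> gives \<open>D * (exp x + exp (-x)) = - 2 * x * exp (-x)\<close>. In an even
  degree \<open>2 * n\<close> the left side involves only the even coefficients of \<open>D\<close>, so the Bernoulli
  numbers of odd index drop out.
\<close>

lemma bernoulli_tanh_identity:
  assumes "n \<ge> 1"
  shows "(\<Sum>j\<le>n. real ((2 * n) choose (2 * j)) * (4 ^ j * (4 ^ j - 1) * bernoulli (2 * j)))
         = 2 * real n"
proof -
  define B where "B c = bernoulli_fps oo (fps_const c * fps_X)" for c :: real
  define D where "D = B 4 - B 2"
  have B: "B c * (fps_exp c - 1) = fps_const c * fps_X" for c
  proof -
    have "(bernoulli_fps * (fps_exp 1 - 1)) oo (fps_const c * fps_X) = fps_const c * fps_X"
      by (simp add: bernoulli_fps_mult_exp)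
    thus ?thesis
      by (simp add: B_def fps_compose_mult_distrib fps_compose_sub_distrib)
  qed
  have nth_D: "fps_nth D m = (4 ^ m - 2 ^ m) * bernoulli m / fact m" for m
    unfolding D_def B_def fps_compose_linear
    by (simp add: bernoulli_fps_def algebra_simps diff_divide_distrib)
  define E2 :: "real fps" where "E2 = fps_exp 2"
  have E4: "fps_exp 4 = E2 * E2"
    using fps_exp_add_mult[of "2::real" 2] by (simp add: E2_def)
  have "D * (fps_exp 4 - 1) = fps_const 4 * fps_X - fps_const 2 * fps_X * (E2 + 1)"
  proof -
    have "D * (fps_exp 4 - 1) = B 4 * (fps_exp 4 - 1) - (B 2 * (fps_exp 2 - 1)) * (E2 + 1)"
      unfolding D_def E4 E2_def[symmetric] by (simp add: algebra_simps)
    thus ?thesis by (simp only: B)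
  qed
  also have "\<dots> = - fps_const 2 * fps_X * (E2 - 1)"
  proof -
    have c4: "fps_const (4::real) = fps_const 2 + fps_const 2" by simp
    have cm: "fps_const (-2::real) = - fps_const 2" by simp
    show ?thesis
      unfolding c4 by (simp add: algebra_simps cm del: fps_const_add fps_const_neg)
  qed
  \<comment> \<open>Since \<open>fps_exp 4 - 1 = (E2 + 1) * (E2 - 1)\<close>, the factor \<open>E2 - 1\<close> can be cancelled.\<close>
  finally have "(D * (E2 + 1)) * (E2 - 1) = (- fps_const 2 * fps_X) * (E2 - 1)"
    unfolding E4 by (simp add: algebra_simps)
  moreover have "E2 - 1 \<noteq> 0"
  proof
    assume "E2 - 1 = 0"
    hence "fps_nth (E2 - 1) 1 = 0" by simp
    thus False by (simp add: E2_def)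
  qed
  ultimately have D: "D * (E2 + 1) = - fps_const 2 * fps_X"
    by simp
  have "fps_exp (-1) * E2 = (fps_exp 1 :: real fps)"
    using fps_exp_add_mult[of "-1::real" 2] by (simp add: E2_def)
  hence "D * (fps_exp 1 + fps_exp (-1)) = (D * (E2 + 1)) * fps_exp (-1)"
    by (simp add: algebra_simps)
  also have "\<dots> = fps_X * (- fps_const 2 * fps_exp (-1))"
    unfolding D by (simp add: algebra_simps)
  finally have "fps_nth (D * (fps_exp 1 + fps_exp (-1))) (2 * n)
      = fps_nth (fps_X * (- fps_const 2 * fps_exp (-1))) (2 * n)" by simp
  also have "\<dots> = 2 / fact (2 * n - 1)"
    using assms by (auto simp: uminus_power_if)
  also have "fps_nth (D * (fps_exp 1 + fps_exp (-1))) (2 * n)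
      = (\<Sum>i\<le>2 * n. fps_nth D i * ((1 + (-1) ^ (2 * n - i)) / fact (2 * n - i)))"
    by (simp add: fps_mult_nth atLeast0AtMost add_divide_distrib)
  also have "\<dots> = (\<Sum>i\<in>(\<lambda>j. 2 * j) ` {..n}. fps_nth D i * ((1 + (-1) ^ (2 * n - i)) / fact (2 * n - i)))"
  proof (rule sum.mono_neutral_right)
    show "\<forall>i\<in>{..2 * n} - (\<lambda>j. 2 * j) ` {..n}.
        fps_nth D i * ((1 + (- 1) ^ (2 * n - i)) / fact (2 * n - i)) = 0"
    proof
      fix i assume i: "i \<in> {..2 * n} - (\<lambda>j. 2 * j) ` {..n}"
      have "odd i"
      proof
        assume "even i"
        then obtain j where "i = 2 * j" by blast
        with i show False by auto
      qed
      with i have "odd (2 * n - i)" by simp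
      thus "fps_nth D i * ((1 + (- 1) ^ (2 * n - i)) / fact (2 * n - i)) = 0" by simp
    qed
  qed auto
  also have "\<dots> = (\<Sum>j\<le>n. 2 * (fps_nth D (2 * j) / fact (2 * n - 2 * j)))"
    by (subst sum.reindex) (auto simp: inj_on_def mult_ac)
  finally have "2 * (\<Sum>j\<le>n. fps_nth D (2 * j) / fact (2 * n - 2 * j)) = 2 * (1 / fact (2 * n - 1))"
    by (simp only: sum_distrib_left)
  hence eq: "(\<Sum>j\<le>n. fps_nth D (2 * j) / fact (2 * n - 2 * j)) = 1 / fact (2 * n - 1)"
    by (simp only: mult_cancel_left) simp
  have "(\<Sum>j\<le>n. real ((2 * n) choose (2 * j)) * (4 ^ j * (4 ^ j - 1) * bernoulli (2 * j)))
      = (\<Sum>j\<le>n. fact (2 * n) * (fps_nth D (2 * j) / fact (2 * n - 2 * j)))"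
  proof (rule sum.cong)
    fix j assume "j \<in> {..n}"
    hence "real ((2 * n) choose (2 * j)) = fact (2 * n) / (fact (2 * j) * fact (2 * n - 2 * j))"
      by (subst binomial_fact) auto
    moreover have "(4::real) ^ (2 * j) - 2 ^ (2 * j) = 4 ^ j * (4 ^ j - 1)"
      by (simp add: power_mult right_diff_distrib flip: power_mult_distrib)
    ultimately show "real ((2 * n) choose (2 * j)) * (4 ^ j * (4 ^ j - 1) * bernoulli (2 * j))
      = fact (2 * n) * (fps_nth D (2 * j) / fact (2 * n - 2 * j))"
      by (simp add: nth_D)
  qed simp
  also have "\<dots> = fact (2 * n) / fact (2 * n - 1)"
    by (simp only: eq flip: sum_distrib_left) simp
  also have "\<dots> = 2 * real n"
    using assms by (subst fact_reduce) auto
  finally show ?thesis .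
qed

section \<open>Scaled Euler polynomials and their sine coefficients\<close>

text \<open>
  This is \<open>pi ^ (2 * n) * E (t / pi)\<close> for the Euler polynomial \<open>E\<close> of degree \<open>2 * n\<close>, written out
  with Bernoulli numbers. Multiplying by \<open>n + 1 / 2\<close> and replacing each \<open>t ^ k\<close> by
  \<open>I_integral k\<close> turns it into the \<open>I_integral (2 * n)\<close> term of the theorem minus the right-hand
  side.
\<close>

definition scaled_euler :: "nat \<Rightarrow> real \<Rightarrow> real" where
  "scaled_euler n t = t ^ (2 * n) - 2 / real (2 * n + 1) *
     (\<Sum>m<n. real ((2 * n + 1) choose (2 * m + 1)) * bernoulli (2 * (n - m))
        * pi ^ (2 * (n - m) - 1) * (2 ^ (2 * (n - m)) - 1) * t ^ (2 * m + 1))"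

text \<open>
  The derivative of \<open>scaled_euler n\<close> with the binomial coefficients already absorbed, which brings
  its vanishing at \<open>pi / 2\<close> into the shape of \<open>bernoulli_tanh_identity\<close>.
\<close>

definition scaled_euler' :: "nat \<Rightarrow> real \<Rightarrow> real" where
  "scaled_euler' n t = 2 * real n * t ^ (2 * n - 1) - 2 *
     (\<Sum>m<n. real ((2 * n) choose (2 * m)) * bernoulli (2 * (n - m))
        * pi ^ (2 * (n - m) - 1) * (2 ^ (2 * (n - m)) - 1) * t ^ (2 * m))"

lemma scaled_euler_0 [simp]: "scaled_euler 0 t = 1"
  by (simp add: scaled_euler_def)

lemma scaled_euler_at_0: "n \<ge> 1 \<Longrightarrow> scaled_euler n 0 = 0"
  by (simp add: scaled_euler_def)

lemma choose_odd: "real (2 * m + 1) * real ((2 * n + 1) choose (2 * m + 1))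
    = real (2 * n + 1) * real ((2 * n) choose (2 * m))"
proof -
  have "(2 * m + 1) * ((2 * n + 1) choose (2 * m + 1)) = (2 * n + 1) * ((2 * n) choose (2 * m))"
    using binomial_absorption[of "2 * m" "2 * n + 1"] by (simp del: binomial_Suc_Suc)
  thus ?thesis by (simp only: flip: of_nat_mult)
qed

lemma choose_even: "real (2 * m + 2) * real ((2 * n + 2) choose (2 * m + 2))
    = real (2 * n + 2) * real ((2 * n + 1) choose (2 * m + 1))"
proof -
  have "(2 * m + 2) * ((2 * n + 2) choose (2 * m + 2)) = (2 * n + 2) * ((2 * n + 1) choose (2 * m + 1))"
    using binomial_absorption[of "2 * m + 1" "2 * n + 2"] by (simp del: binomial_Suc_Suc)
  thus ?thesis by (simp only: flip: of_nat_mult)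
qed

lemma DERIV_sum_powers:
  "((\<lambda>t. \<Sum>m\<in>A. c m * t ^ e m) has_real_derivative (\<Sum>m\<in>A. c m * (real (e m) * t ^ (e m - 1)))) (at t)"
  by (auto intro!: derivative_eq_intros sum.cong)

lemma has_derivative_scaled_euler:
  "(scaled_euler n has_real_derivative scaled_euler' n t) (at t)"
proof -
  let ?c = "\<lambda>m. bernoulli (2 * (n - m)) * pi ^ (2 * (n - m) - 1) * (2 ^ (2 * (n - m)) - 1)"
  have "(scaled_euler n has_real_derivative (2 * real n * t ^ (2 * n - 1)
      - 2 / real (2 * n + 1) * (\<Sum>m<n. real ((2 * n + 1) choose (2 * m + 1)) * ?c m
          * (real (2 * m + 1) * t ^ (2 * m))))) (at t)"
    unfolding scaled_euler_def
    by (rule DERIV_cong[OF DERIV_diff[OF DERIV_pow DERIV_cmult[OF DERIV_sum_powers]]])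
      (simp add: mult.assoc del: binomial_Suc_Suc)
  also have "(\<Sum>m<n. real ((2 * n + 1) choose (2 * m + 1)) * ?c m * (real (2 * m + 1) * t ^ (2 * m)))
      = (\<Sum>m<n. (real (2 * m + 1) * real ((2 * n + 1) choose (2 * m + 1))) * ?c m * t ^ (2 * m))"
    by (intro sum.cong refl) (simp only: mult_ac)
  also have "\<dots> = real (2 * n + 1) * (\<Sum>m<n. real ((2 * n) choose (2 * m)) * ?c m * t ^ (2 * m))"
    unfolding choose_odd sum_distrib_left by (intro sum.cong refl) (simp only: mult_ac)
  finally show ?thesis
    by (simp add: scaled_euler'_def mult_ac)
qed

text \<open>
  Differentiating twice lowers \<open>n\<close> by one: the second derivative of the Euler polynomial of
  degree \<open>k\<close> is \<open>k * (k - 1)\<close> times that of degree \<open>k - 2\<close>. Apart from the binomials, the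
  coefficients of \<open>scaled_euler\<close> depend on \<open>n - m\<close> only, so shifting both indices matches them; the term \<open>m = 0\<close> is constant in
  the first derivative and disappears.
\<close>

lemma has_derivative_scaled_euler':
  "(scaled_euler' (Suc n) has_real_derivative
      (real (2 * n + 2) * real (2 * n + 1) * scaled_euler n t)) (at t)"
proof -
  let ?c = "\<lambda>m. bernoulli (2 * (n - m)) * pi ^ (2 * (n - m) - 1) * (2 ^ (2 * (n - m)) - 1)"
  let ?d = "bernoulli (2 * Suc n) * pi ^ (2 * Suc n - 1) * (2 ^ (2 * Suc n) - 1)"
  have "scaled_euler' (Suc n) = (\<lambda>t. real (2 * n + 2) * t ^ (2 * n + 1) - 2 *
     (?d + (\<Sum>m<n. real ((2 * n + 2) choose (2 * m + 2)) * ?c m * t ^ (2 * m + 2))))"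
    unfolding scaled_euler'_def sum.lessThan_Suc_shift by (simp add: mult_ac)
  moreover have "((\<lambda>t. real (2 * n + 2) * t ^ (2 * n + 1) - 2 *
     (?d + (\<Sum>m<n. real ((2 * n + 2) choose (2 * m + 2)) * ?c m * t ^ (2 * m + 2))))
     has_real_derivative (real (2 * n + 2) * (real (2 * n + 1) * t ^ (2 * n)) - 2 *
     (\<Sum>m<n. real ((2 * n + 2) choose (2 * m + 2)) * ?c m * (real (2 * m + 2) * t ^ (2 * m + 1))))) (at t)"
    by (rule DERIV_cong[OF DERIV_diff[OF DERIV_cmult[OF DERIV_pow]
          DERIV_cmult[OF DERIV_add[OF DERIV_const DERIV_sum_powers]]]])
      (simp del: binomial_Suc_Suc)
  moreover have "(\<Sum>m<n. real ((2 * n + 2) choose (2 * m + 2)) * ?c m * (real (2 * m + 2) * t ^ (2 * m + 1)))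
     = (\<Sum>m<n. (real (2 * m + 2) * real ((2 * n + 2) choose (2 * m + 2))) * ?c m * t ^ (2 * m + 1))"
    by (intro sum.cong refl) (simp only: mult_ac)
  moreover have "\<dots> = real (2 * n + 2) * (\<Sum>m<n. real ((2 * n + 1) choose (2 * m + 1)) * ?c m * t ^ (2 * m + 1))"
    unfolding choose_even sum_distrib_left by (intro sum.cong refl) (simp only: mult_ac)
  moreover have "real (2 * n + 2) * (real (2 * n + 1) * p) - 2 * (real (2 * n + 2) * s)
      = real (2 * n + 2) * real (2 * n + 1) * (p - 2 / real (2 * n + 1) * s)" for p s :: real
    by (simp add: field_simps)
  ultimately show ?thesis
    by (simp only: scaled_euler_def mult.assoc)
qed

text \<open>
  The Euler polynomials of even degree are symmetric about \<open>1 / 2\<close>, which corresponds to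
  \<open>t = pi / 2\<close>, so the derivative has to vanish there. In terms of coefficients this is exactly
  \<open>bernoulli_tanh_identity\<close>: the powers of \<open>pi\<close> all combine to \<open>pi ^ (2 * n - 1)\<close>, and \<open>(1 / 2) ^ (2 * m)\<close> becomes
  \<open>4 ^ (n - m) / 4 ^ n\<close>.
\<close>

lemma scaled_euler'_half_pi:
  assumes "n \<ge> 1"
  shows "scaled_euler' n (pi / 2) = 0"
proof -
  have "(\<Sum>m<n. real ((2 * n) choose (2 * m)) * bernoulli (2 * (n - m))
        * pi ^ (2 * (n - m) - 1) * (2 ^ (2 * (n - m)) - 1) * (pi / 2) ^ (2 * m))
      = (\<Sum>j\<in>{1..n}. real ((2 * n) choose (2 * (n - j))) * bernoulli (2 * j)
        * pi ^ (2 * j - 1) * (2 ^ (2 * j) - 1) * (pi / 2) ^ (2 * (n - j)))"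
    by (rule sum.reindex_bij_witness[of _ "\<lambda>j. n - j" "\<lambda>m. n - m"]) auto
  also have "\<dots> = (\<Sum>j\<in>{1..n}. pi ^ (2 * n - 1) / 4 ^ n *
       (real ((2 * n) choose (2 * j)) * (4 ^ j * (4 ^ j - 1) * bernoulli (2 * j))))"
  proof (rule sum.cong)
    fix j assume j: "j \<in> {1..n}"
    have ch: "(2 * n) choose (2 * (n - j)) = (2 * n) choose (2 * j)"
      using j binomial_symmetric[of "2 * j" "2 * n"] by (simp add: diff_mult_distrib2)
    have "2 * j - 1 + 2 * (n - j) = 2 * n - 1" using j by auto
    hence p: "pi ^ (2 * j - 1) * pi ^ (2 * (n - j)) = pi ^ (2 * n - 1)"
      by (simp flip: power_add)
    have "(4::real) ^ j * 4 ^ (n - j) = 4 ^ n" using j by (simp flip: power_add)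
    hence q: "1 / (4::real) ^ (n - j) = 4 ^ j / 4 ^ n" by (simp add: field_simps)
    have r: "(pi / 2) ^ (2 * (n - j)) = pi ^ (2 * (n - j)) * (1 / 4 ^ (n - j))"
      by (simp add: power_divide power_mult)
    have s: "(2::real) ^ (2 * j) = 4 ^ j" by (simp add: power_mult)
    have "real ((2 * n) choose (2 * (n - j))) * bernoulli (2 * j)
        * pi ^ (2 * j - 1) * (2 ^ (2 * j) - 1) * (pi / 2) ^ (2 * (n - j))
      = (pi ^ (2 * j - 1) * pi ^ (2 * (n - j))) *
        (real ((2 * n) choose (2 * j)) * bernoulli (2 * j) * (4 ^ j - 1) * (4 ^ j / 4 ^ n))"
      unfolding r s ch q by (simp only: mult_ac)
    thus "real ((2 * n) choose (2 * (n - j))) * bernoulli (2 * j)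
        * pi ^ (2 * j - 1) * (2 ^ (2 * j) - 1) * (pi / 2) ^ (2 * (n - j))
      = pi ^ (2 * n - 1) / 4 ^ n *
       (real ((2 * n) choose (2 * j)) * (4 ^ j * (4 ^ j - 1) * bernoulli (2 * j)))"
      unfolding p by simp
  qed simp
  also have "\<dots> = pi ^ (2 * n - 1) / 4 ^ n *
      (\<Sum>j\<in>{1..n}. real ((2 * n) choose (2 * j)) * (4 ^ j * (4 ^ j - 1) * bernoulli (2 * j)))"
    by (simp only: sum_distrib_left)
  also have "(\<Sum>j\<in>{1..n}. real ((2 * n) choose (2 * j)) * (4 ^ j * (4 ^ j - 1) * bernoulli (2 * j)))
      = (\<Sum>j\<le>n. real ((2 * n) choose (2 * j)) * (4 ^ j * (4 ^ j - 1) * bernoulli (2 * j)))"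
    by (rule sum.mono_neutral_left) (auto simp: not_le)
  also have "\<dots> = 2 * real n"
    by (rule bernoulli_tanh_identity[OF assms])
  finally have sum: "(\<Sum>m<n. real ((2 * n) choose (2 * m)) * bernoulli (2 * (n - m))
        * pi ^ (2 * (n - m) - 1) * (2 ^ (2 * (n - m)) - 1) * (pi / 2) ^ (2 * m))
      = pi ^ (2 * n - 1) / 4 ^ n * (2 * real n)" .
  have "(4::real) ^ n = 2 * 2 ^ (2 * n - 1)"
    using assms by (simp add: power_mult flip: power_Suc)
  thus ?thesis
    unfolding scaled_euler'_def sum by (simp add: power_divide)
qed

text \<open>
  Two integrations by parts pass from \<open>n + 1\<close> to \<open>n\<close> and contribute the factor
  \<open>- (2 * n + 2) * (2 * n + 1) / a ^ 2\<close>. Every boundary term vanishes: at \<open>0\<close> the polynomial and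
  the sine are zero, at \<open>pi / 2\<close> the derivative of the polynomial and \<open>cos (a * t)\<close> are zero,
  the latter because \<open>a\<close> is odd.
\<close>

lemma scaled_euler_sine_coefficient:
  fixes k :: nat
  defines "a \<equiv> real (2 * k + 1)"
  shows "((\<lambda>t. scaled_euler n t * sin (a * t)) has_integral
           ((-1) ^ n * fact (2 * n) / a ^ (2 * n + 1))) {0..pi/2}"
proof (induction n)
  have a: "a > 0" by (simp add: a_def)
  have cos_a: "cos (a * (pi / 2)) = 0"
    using cos_pi_eq_zero[of k] by (simp add: a_def mult_ac)
  case 0
  have "((\<lambda>t. sin (a * t)) has_integral (- cos (a * (pi / 2)) / a - (- cos (a * 0) / a))) {0..pi/2}"
    using a by (intro fundamental_theorem_of_calculus)
      (auto intro!: derivative_eq_intros simp flip: has_real_derivative_iff_has_vector_derivative)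
  thus ?case using cos_a by simp
next
  have a: "a > 0" by (simp add: a_def)
  have cos_a: "cos (a * (pi / 2)) = 0"
    using cos_pi_eq_zero[of k] by (simp add: a_def mult_ac)
  case (Suc n)
  let ?c = "real (2 * n + 2) * real (2 * n + 1)"
  let ?F = "\<lambda>t. - scaled_euler (Suc n) t * cos (a * t) / a + scaled_euler' (Suc n) t * sin (a * t) / a\<^sup>2"
  have "((\<lambda>t. scaled_euler (Suc n) t * sin (a * t) + ?c / a\<^sup>2 * (scaled_euler n t * sin (a * t)))
      has_integral (?F (pi / 2) - ?F 0)) {0..pi/2}"
  proof (rule fundamental_theorem_of_calculus)
    fix t assume "t \<in> {0..pi/2}"
    have "(?F has_real_derivative (scaled_euler (Suc n) t * sin (a * t)
        + ?c / a\<^sup>2 * (scaled_euler n t * sin (a * t)))) (at t)"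
      using a by (auto intro!: derivative_eq_intros has_derivative_scaled_euler
          has_derivative_scaled_euler' simp: field_simps power2_eq_square)
    thus "(?F has_vector_derivative (scaled_euler (Suc n) t * sin (a * t)
        + ?c / a\<^sup>2 * (scaled_euler n t * sin (a * t)))) (at t within {0..pi/2})"
      by (simp add: has_real_derivative_iff_has_vector_derivative has_vector_derivative_at_within)
  qed simp
  moreover have "?F (pi / 2) - ?F 0 = 0"
    using cos_a scaled_euler'_half_pi[of "Suc n"] scaled_euler_at_0[of "Suc n"] by simp
  ultimately have "((\<lambda>t. (scaled_euler (Suc n) t * sin (a * t) + ?c / a\<^sup>2 * (scaled_euler n t * sin (a * t)))
      - ?c / a\<^sup>2 * (scaled_euler n t * sin (a * t)))
      has_integral (0 - ?c / a\<^sup>2 * ((-1) ^ n * fact (2 * n) / a ^ (2 * n + 1)))) {0..pi/2}"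
    by (intro has_integral_diff has_integral_mult_right Suc.IH) simp
  moreover have "0 - ?c / a\<^sup>2 * ((-1) ^ n * fact (2 * n) / a ^ (2 * n + 1))
      = (-1) ^ Suc n * fact (2 * Suc n) / a ^ (2 * Suc n + 1)"
  proof -
    have "fact (2 * Suc n) = ?c * fact (2 * n)" by (simp add: algebra_simps)
    moreover have "a ^ (2 * Suc n + 1) = a\<^sup>2 * a ^ (2 * n + 1)" by (simp add: power2_eq_square)
    ultimately show ?thesis by (simp only:) simp
  qed
  ultimately show ?case by simp
qed

section \<open>Integrals against the reciprocal sine as series\<close>

text \<open>
  For a continuously differentiable function one integration by parts bounds the integral by a
  multiple of \<open>1 / N\<close>. A continuous function is uniformly close to a polynomial, and the error
  made by replacing it is bounded independently of \<open>N\<close>.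
\<close>

lemma riemann_lebesgue_cos:
  fixes g :: "real \<Rightarrow> real"
  assumes "a \<le> b" and cont: "continuous_on {a..b} g"
  shows "(\<lambda>N. integral {a..b} (\<lambda>t. g t * cos (real N * t))) \<longlonglongrightarrow> 0"
proof (rule LIMSEQ_I)
  fix e :: real assume "e > 0"
  \<comment> \<open>The summand \<open>1\<close> keeps \<open>d\<close> positive and well defined when \<open>a = b\<close>.\<close>
  define d where "d = e / 2 / (b - a + 1)"
  have "d > 0" using \<open>e > 0\<close> \<open>a \<le> b\<close> by (simp add: d_def)
  have d: "d * (b - a) < e / 2"
    using \<open>e > 0\<close> \<open>a \<le> b\<close> by (simp add: d_def field_simps)
  obtain p where p: "real_polynomial_function p" and gp: "\<And>x. x \<in> {a..b} \<Longrightarrow> \<bar>g x - p x\<bar> < d"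
    using Stone_Weierstrass_real_polynomial_function[OF _ cont \<open>d > 0\<close>] by auto
  obtain p' where p': "real_polynomial_function p'"
    and dp: "\<And>x. (p has_real_derivative p' x) (at x)"
    using has_real_derivative_polynomial_function[OF p] by blast
  have cont_p: "continuous_on S p" "continuous_on S p'" for S
    using p p' by (auto intro: continuous_on_polymonial_function simp: real_polynomial_function_eq)
  obtain M where M: "\<And>x. x \<in> {a..b} \<Longrightarrow> \<bar>p' x\<bar> \<le> M" "M \<ge> 0"
  proof -
    have "bounded (p' ` {a..b})"
      by (intro compact_imp_bounded compact_continuous_image cont_p compact_Icc)
    then obtain M where "M > 0" "\<forall>y\<in>p' ` {a..b}. norm y \<le> M"
      by (auto simp: bounded_pos)
    thus thesis by (intro that[of M]) auto
  qed
  define C where "C = \<bar>p a\<bar> + \<bar>p b\<bar> + M * (b - a)"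
  have p_bound: "\<bar>integral {a..b} (\<lambda>t. p t * cos (real N * t))\<bar> \<le> C / real N" if "N > 0" for N
  proof -
    have "((\<lambda>t. p' t * (sin (real N * t) / N) + p t * cos (real N * t)) has_integral
        (p b * (sin (real N * b) / N) - p a * (sin (real N * a) / N))) {a..b}"
      using that \<open>a \<le> b\<close> by (intro fundamental_theorem_of_calculus)
        (auto intro!: derivative_eq_intros DERIV_subset[OF dp] simp: add_divide_distrib
          simp flip: has_real_derivative_iff_has_vector_derivative)
    moreover have int: "(\<lambda>t. p' t * (sin (real N * t) / N)) integrable_on {a..b}"
      by (intro integrable_continuous_real continuous_intros cont_p) (use that in auto)
    ultimately have "((\<lambda>t. p' t * (sin (real N * t) / N) + p t * cos (real N * t)
        - p' t * (sin (real N * t) / N)) has_integral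
        (p b * (sin (real N * b) / N) - p a * (sin (real N * a) / N)
         - integral {a..b} (\<lambda>t. p' t * (sin (real N * t) / N)))) {a..b}"
      by (intro has_integral_diff integrable_integral)
    hence eq: "integral {a..b} (\<lambda>t. p t * cos (real N * t)) =
        p b * (sin (real N * b) / N) - p a * (sin (real N * a) / N)
         - integral {a..b} (\<lambda>t. p' t * (sin (real N * t) / N))"
      by (simp add: integral_unique)
    have sin_bound: "\<bar>c * (sin x / N)\<bar> \<le> \<bar>c\<bar> / N" for c x :: real
      using mult_left_le[of "\<bar>sin x\<bar>" "\<bar>c\<bar>"] by (simp add: abs_mult divide_right_mono)
    have "norm (integral {a..b} (\<lambda>t. p' t * (sin (real N * t) / N))) \<le> M / N * (b - a)"
    proof (rule integral_bound)
      show "continuous_on {a..b} (\<lambda>t. p' t * (sin (real N * t) / N))"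
        by (intro continuous_intros cont_p) (use that in auto)
      fix t assume "t \<in> {a..b}"
      hence "\<bar>p' t\<bar> / N \<le> M / N" using M(1) by (intro divide_right_mono) auto
      thus "norm (p' t * (sin (real N * t) / N)) \<le> M / N"
        using sin_bound[of "p' t" "real N * t"] by simp
    qed fact
    hence "\<bar>integral {a..b} (\<lambda>t. p t * cos (real N * t))\<bar> \<le> \<bar>p b\<bar> / N + \<bar>p a\<bar> / N + M / N * (b - a)"
      unfolding eq real_norm_def
      using sin_bound[of "p b" "real N * b"] sin_bound[of "p a" "real N * a"] by linarith
    thus ?thesis by (simp add: C_def add_divide_distrib)
  qed
  show "\<exists>N0. \<forall>N\<ge>N0. norm (integral {a..b} (\<lambda>t. g t * cos (real N * t)) - 0) < e"
  proof (intro exI allI impI)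
    fix N assume N: "N \<ge> Suc (nat \<lceil>2 * C / e\<rceil>)"
    hence "N > 0" by simp
    have "2 * C / e < real N" using N by linarith
    hence "C / real N < e / 2"
      using \<open>N > 0\<close> \<open>e > 0\<close> by (simp add: field_simps)
    with p_bound[OF \<open>N > 0\<close>] have p_small: "\<bar>integral {a..b} (\<lambda>t. p t * cos (real N * t))\<bar> < e / 2"
      by linarith
    have int: "(\<lambda>t. p t * cos (real N * t)) integrable_on {a..b}"
        "(\<lambda>t. (g t - p t) * cos (real N * t)) integrable_on {a..b}"
      by (intro integrable_continuous_real continuous_intros cont_p cont)+
    have "norm (integral {a..b} (\<lambda>t. (g t - p t) * cos (real N * t))) \<le> d * (b - a)"
    proof (rule integral_bound)
      show "continuous_on {a..b} (\<lambda>t. (g t - p t) * cos (real N * t))"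
        by (intro continuous_intros cont_p cont)
      fix t assume "t \<in> {a..b}"
      thus "norm ((g t - p t) * cos (real N * t)) \<le> d"
        using gp[of t] mult_left_le[of "\<bar>cos (real N * t)\<bar>" "\<bar>g t - p t\<bar>"] by (simp add: abs_mult)
    qed fact
    moreover have "integral {a..b} (\<lambda>t. g t * cos (real N * t)) =
        integral {a..b} (\<lambda>t. (g t - p t) * cos (real N * t)) + integral {a..b} (\<lambda>t. p t * cos (real N * t))"
      by (subst integral_add[OF int(2,1), symmetric]) (simp add: algebra_simps)
    ultimately show "norm (integral {a..b} (\<lambda>t. g t * cos (real N * t)) - 0) < e"
      using p_small d by simp
  qed
qed

lemma dirichlet_kernel_odd:
  "2 * sin t * (\<Sum>k<N. sin (real (2 * k + 1) * t)) = 1 - cos (real (2 * N) * t)"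
proof (induction N)
  case (Suc N)
  have "cos (real (2 * N) * t) - cos (real (2 * Suc N) * t) = 2 * sin t * sin (real (2 * N + 1) * t)"
    by (subst cos_diff_cos) (simp add: algebra_simps add_divide_distrib)
  with Suc show ?case by (simp add: algebra_simps)
qed simp

lemma continuous_on_div_sin:
  "continuous_on {0..pi/2} (\<lambda>t::real. if t = 0 then 1 else t / sin t)"
  unfolding continuous_on_def
proof
  fix x :: real assume x: "x \<in> {0..pi/2}"
  show "((\<lambda>t. if t = 0 then 1 else t / sin t) \<longlongrightarrow> (if x = 0 then 1 else x / sin x)) (at x within {0..pi/2})"
  proof (cases "x = 0")
    case True
    have "((\<lambda>t. sin t / t) \<longlongrightarrow> 1) (at (0::real))"
      using DERIV_sin[of 0] by (simp add: DERIV_def del: DERIV_sin)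
    hence "((\<lambda>t. inverse (sin t / t)) \<longlongrightarrow> inverse 1) (at (0::real))"
      by (rule tendsto_inverse) simp
    hence "((\<lambda>t::real. if t = 0 then 1 else t / sin t) \<longlongrightarrow> 1) (at 0)"
      unfolding inverse_1 by (rule Lim_transform_eventually) (auto simp: eventually_at_filter)
    thus ?thesis using True by (auto intro: tendsto_within_subset)
  next
    case False
    have "sin x \<noteq> 0"
      using x False sin_gt_zero[of x] pi_gt_zero by (auto simp: less_le)
    hence "((\<lambda>t. t / sin t) \<longlongrightarrow> x / sin x) (at x within {0..pi/2})"
      by (intro tendsto_intros)
    moreover have "eventually (\<lambda>t. t \<noteq> 0) (at x within {0..pi/2})"
      using False by (intro eventually_neq_at_within)
    ultimately have "((\<lambda>t. if t = 0 then 1 else t / sin t) \<longlongrightarrow> x / sin x) (at x within {0..pi/2})"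
      by (rule Lim_transform_eventually[OF _ eventually_mono]) auto
    thus ?thesis using False by simp
  qed
qed

text \<open>
  Integrating \<open>p t / sin t\<close> against \<open>1 - cos (2 * N * t)\<close> gives the partial sums of the series, by
  \<open>dirichlet_kernel_odd\<close>. The factor \<open>t\<close> in \<open>p\<close> makes \<open>p t / sin t\<close> continuous up to \<open>0\<close>, so
  the oscillating part tends to \<open>0\<close>.
\<close>

lemma integral_div_sin_eq_sine_series:
  fixes p q :: "real \<Rightarrow> real"
  assumes q: "continuous_on {0..pi/2} q" and p: "\<And>t. p t = t * q t"
    and c: "\<And>k. ((\<lambda>t. p t * sin (real (2 * k + 1) * t)) has_integral c k) {0..pi/2}"
  shows "(\<lambda>k. 2 * c k) sums integral {0..pi/2} (\<lambda>t. p t / sin t)"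
proof -
  define g where "g t = q t * (if t = 0 then 1 else t / sin t)" for t
  have g: "continuous_on {0..pi/2} g"
    unfolding g_def by (intro continuous_on_mult q continuous_on_div_sin)
  have g_eq: "p t / sin t = g t" if "t \<noteq> 0" for t
    using that by (simp add: g_def p)
  have g_int: "integral {0..pi/2} (\<lambda>t. p t / sin t) = integral {0..pi/2} g"
    by (rule integral_spike[of "{0}"]) (auto simp: g_eq)
  have "(\<Sum>k<N. 2 * c k) = integral {0..pi/2} g - integral {0..pi/2} (\<lambda>t. g t * cos (real (2 * N) * t))" for N
  proof -
    have "((\<lambda>t. \<Sum>k<N. 2 * (p t * sin (real (2 * k + 1) * t))) has_integral (\<Sum>k<N. 2 * c k)) {0..pi/2}"
      by (intro has_integral_sum has_integral_mult_right c) auto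
    hence "((\<lambda>t. g t - g t * cos (real (2 * N) * t)) has_integral (\<Sum>k<N. 2 * c k)) {0..pi/2}"
    proof (rule has_integral_spike[of "{0}", rotated 2])
      fix t :: real assume t: "t \<in> {0..pi/2} - {0}"
      hence s: "sin t > 0" by (intro sin_gt_zero) auto
      have "g t - g t * cos (real (2 * N) * t) = p t / sin t * (1 - cos (real (2 * N) * t))"
        using g_eq[of t] t by (simp add: algebra_simps)
      also have "\<dots> = 2 * p t * (\<Sum>k<N. sin (real (2 * k + 1) * t))"
        using s unfolding dirichlet_kernel_odd[symmetric] by simp
      finally show "g t - g t * cos (real (2 * N) * t) = (\<Sum>k<N. 2 * (p t * sin (real (2 * k + 1) * t)))"
        by (simp only: sum_distrib_left mult.assoc)
    qed simp
    moreover have "((\<lambda>t. g t - g t * cos (real (2 * N) * t)) has_integral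
        (integral {0..pi/2} g - integral {0..pi/2} (\<lambda>t. g t * cos (real (2 * N) * t)))) {0..pi/2}"
      by (intro has_integral_diff integrable_integral integrable_continuous_real continuous_intros g)
    ultimately show ?thesis by (rule has_integral_unique)
  qed
  moreover have "(\<lambda>N. integral {0..pi/2} g - integral {0..pi/2} (\<lambda>t. g t * cos (real (2 * N) * t)))
      \<longlonglongrightarrow> integral {0..pi/2} g - 0"
  proof (intro tendsto_diff tendsto_const)
    have "filterlim (\<lambda>N::nat. 2 * N) sequentially sequentially"
      by (rule filterlim_subseq) (simp add: strict_mono_def)
    from filterlim_compose[OF riemann_lebesgue_cos[OF _ g] this]
    show "(\<lambda>N. integral {0..pi/2} (\<lambda>t. g t * cos (real (2 * N) * t))) \<longlonglongrightarrow> 0"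
      by simp
  qed
  ultimately show ?thesis by (simp add: sums_def g_int)
qed

section \<open>The zeta value and the integrals\<close>

text \<open>
  Grouping the zeta series in pairs separates odd from even denominators; the even ones
  contribute the fraction \<open>1 / 2 ^ s\<close> of the whole.
\<close>

lemma odd_reciprocal_sums:
  assumes "s \<ge> 2"
  shows "(\<lambda>k. 1 / real (2 * k + 1) ^ s) sums ((1 - 1 / 2 ^ s) * riemann_zeta (real s))"
proof -
  define f where "f = (\<lambda>k. 1 / real (Suc k) ^ s)"
  have summ: "summable f"
    using inverse_power_summable[OF assms, where 'a = real] summable_Suc_iff[of "\<lambda>n. inverse (real n ^ s)"]
    by (simp add: f_def inverse_eq_divide)
  have "riemann_zeta (real s) = suminf f"
    by (simp add: riemann_zeta_def f_def powr_realpow del: of_nat_Suc)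
  with summ have f: "f sums riemann_zeta (real s)" by (simp add: sums_iff)
  have "(\<lambda>k. sum f {k * 2..<k * 2 + 2}) sums riemann_zeta (real s)"
    by (rule sums_group[OF f]) simp
  moreover have "{k * 2..<k * 2 + 2} = {k * 2, k * 2 + 1}" for k :: nat by auto
  ultimately have "(\<lambda>k. f (2 * k) + f (2 * k + 1)) sums riemann_zeta (real s)" by (simp add: mult.commute)
  moreover have "f (2 * k + 1) = 1 / 2 ^ s * f k" for k
    by (simp add: f_def field_simps flip: power_mult_distrib)
  moreover have "(\<lambda>k. 1 / 2 ^ s * f k) sums (1 / 2 ^ s * riemann_zeta (real s))"
    by (rule sums_mult[OF f])
  ultimately have "(\<lambda>k. f (2 * k) + 1 / 2 ^ s * f k - 1 / 2 ^ s * f k) sums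
      (riemann_zeta (real s) - 1 / 2 ^ s * riemann_zeta (real s))"
    by (intro sums_diff) auto
  thus ?thesis by (simp add: f_def algebra_simps)
qed

lemma has_integral_I_integral:
  assumes "m \<ge> 1"
  shows "((\<lambda>t. t ^ m / sin t) has_integral I_integral m) {0..pi/2}"
proof -
  have "(\<lambda>t. t ^ (m - 1) * (if t = 0 then 1 else t / sin t)) integrable_on {0..pi/2}"
    by (intro integrable_continuous_real continuous_intros continuous_on_div_sin)
  hence "(\<lambda>t. t ^ m / sin t) integrable_on {0..pi/2}"
  proof (rule integrable_spike[of _ _ "{0}"])
    fix t :: real assume "t \<in> {0..pi/2} - {0}"
    thus "t ^ m / sin t = t ^ (m - 1) * (if t = 0 then 1 else t / sin t)"
      using assms by (cases m) auto
  qed simp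
  thus ?thesis by (simp add: I_integral_def integrable_integral)
qed

lemma has_integral_scaled_euler_div_sin:
  assumes "n \<ge> 1"
  shows "((\<lambda>t. scaled_euler n t / sin t) has_integral
     (I_integral (2 * n) - 2 / real (2 * n + 1) *
       (\<Sum>m<n. real ((2 * n + 1) choose (2 * m + 1)) * bernoulli (2 * (n - m))
          * pi ^ (2 * (n - m) - 1) * (2 ^ (2 * (n - m)) - 1) * I_integral (2 * m + 1)))) {0..pi/2}"
proof -
  have "scaled_euler n t / sin t = t ^ (2 * n) / sin t - 2 / real (2 * n + 1) *
      (\<Sum>m<n. real ((2 * n + 1) choose (2 * m + 1)) * bernoulli (2 * (n - m))
         * pi ^ (2 * (n - m) - 1) * (2 ^ (2 * (n - m)) - 1) * (t ^ (2 * m + 1) / sin t))" for t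
    by (simp only: scaled_euler_def diff_divide_distrib sum_divide_distrib
        times_divide_eq_right[symmetric])
  thus ?thesis
    using assms
    by (simp only:) (intro has_integral_diff has_integral_mult_right has_integral_sum
        has_integral_I_integral; simp)
qed

theorem mainTheorem13:
  fixes n :: nat
  assumes "n \<ge> 1"
  shows "(-1) ^ (n + 1) * fact (2 * n + 1) * (1 - 1 / 2 ^ (2 * n + 1)) * riemann_zeta (real (2 * n + 1))
           + (real n + 1 / 2) * I_integral (2 * n)
         = (\<Sum>m = 0..n - 1. real ((2 * n + 1) choose (2 * m + 1)) * bernoulli (2 * (n - m))
              * pi ^ (2 * (n - m) - 1) * (2 ^ (2 * (n - m)) - 1) * I_integral (2 * m + 1))"
proof -
  define S where "S = (\<Sum>m<n. real ((2 * n + 1) choose (2 * m + 1)) * bernoulli (2 * (n - m))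
      * pi ^ (2 * (n - m) - 1) * (2 ^ (2 * (n - m)) - 1) * I_integral (2 * m + 1))"
  define Z where "Z = (1 - 1 / 2 ^ (2 * n + 1)) * riemann_zeta (real (2 * n + 1))"
  define q where "q t = t ^ (2 * n - 1) - 2 / real (2 * n + 1) *
     (\<Sum>m<n. real ((2 * n + 1) choose (2 * m + 1)) * bernoulli (2 * (n - m))
        * pi ^ (2 * (n - m) - 1) * (2 ^ (2 * (n - m)) - 1) * t ^ (2 * m))" for t
  have q: "scaled_euler n t = t * q t" for t
  proof -
    have "t ^ (2 * n) = t * t ^ (2 * n - 1)"
      using assms by (simp flip: power_Suc)
    thus ?thesis
      unfolding scaled_euler_def q_def
      by (simp add: right_diff_distrib sum_distrib_left mult_ac del: binomial_Suc_Suc)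
  qed
  have "continuous_on {0..pi/2} q"
    unfolding q_def by (intro continuous_intros)
  hence "(\<lambda>k. 2 * ((-1) ^ n * fact (2 * n) / real (2 * k + 1) ^ (2 * n + 1))) sums
      integral {0..pi/2} (\<lambda>t. scaled_euler n t / sin t)"
    by (rule integral_div_sin_eq_sine_series) (rule q, rule scaled_euler_sine_coefficient)
  moreover have "(\<lambda>k. 2 * (-1) ^ n * fact (2 * n) * (1 / real (2 * k + 1) ^ (2 * n + 1))) sums
      (2 * (-1) ^ n * fact (2 * n) * Z)"
    unfolding Z_def by (intro sums_mult odd_reciprocal_sums) (use assms in simp)
  ultimately have "integral {0..pi/2} (\<lambda>t. scaled_euler n t / sin t) = 2 * (-1) ^ n * fact (2 * n) * Z"
    by (simp add: sums_iff mult_ac)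
  hence "2 * (-1) ^ n * fact (2 * n) * Z = I_integral (2 * n) - 2 / real (2 * n + 1) * S"
    using has_integral_scaled_euler_div_sin[OF assms] by (simp only: S_def integral_unique)
  hence "(real n + 1 / 2) * (2 * (-1) ^ n * fact (2 * n) * Z)
      = (real n + 1 / 2) * I_integral (2 * n) - S"
    by (simp add: field_simps)
  moreover have "(real n + 1 / 2) * (2 * (-1) ^ n * fact (2 * n) * Z) = (-1) ^ n * fact (2 * n + 1) * Z"
    by (simp add: algebra_simps)
  moreover have "{0..n - 1} = {..<n}" using assms by auto
  ultimately show ?thesis
    by (simp only: S_def Z_def mult.assoc) simp
qed

end
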